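(* Let $\Gamma_1,\Gamma_2,\Gamma\in M(n,d)$, and let the structure constants $c^{\Gamma}_{\Gamma_1\Gamma_2}$ be defined by $\xi_{\Gamma_1}\xi_{\Gamma_2}=\sum_{\Gamma\in M(n,d)}c^{\Gamma}_{\Gamma_1\Gamma_2}\,\xi_\Gamma$ in $\mathrm{S}_F(n,d)$. Let $l$ be any labelling of $\Gamma$. Then $c^{\Gamma}_{\Gamma_1\Gamma_2}$ is the number (taken in $F$) of pairs $(l_1,l_2)$, with $l_1$ a labelling of $\Gamma_1$ and $l_2$ a labelling of $\Gamma_2$, that are compatible with $l$.
   Context: Let $F$ be a field of characteristic different from $2$, and $n,d$ positive integers; $[n]=\{1,\dots,n\}$, $[n']=\{1',\dots,n'\}$. $B(n,d)$ is the set of $n$-tuples $S=(S_1,\dots,S_n)$ of pairwise disjoint (possibly empty) sets with union $[d]$; the symmetric group $\mathbf{S}_d$ acts on the right by $S\cdot w=(w^{-1}(S_1),\dots,w^{-1}(S_n))$. $F[B(n,d)]$ is the space of functions $B(n,d)\to F$ with action $(\rho(w)f)(S)=f(S\cdot w)$; it is isomorphic to $(F^n)^{\otimes d}$ with $\mathbf{S}_d$ permuting tensor factors. The Schur algebra is $\mathrm{S}_F(n,d)=\mathrm{End}_{\mathbf{S}_d}((F^n)^{\otimes d})=\mathrm{End}_{\mathbf{S}_d}(F[B(n,d)])$, with composition as product. $M(n,d)$ is the set of bipartite multigraphs with vertex set $[n']\coprod[n]$ and $d$ edges (each edge joins a vertex of $[n']$ to a vertex of $[n]$). A labelling of $\Gamma\in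 M(n,d)$ is a function $l:[d]\to[n']\times[n]$ such that $|l^{-1}(i',j)|$ is the number of edges of $\Gamma$ joining $i'$ and $j$, for all $i,j$. For $S,T\in B(n,d)$, $\Gamma_{S,T}\in M(n,d)$ is the multigraph with $|S_j\cap T_i|$ edges between $i'$ and $j$. For $\Gamma\in M(n,d)$, $\xi_\Gamma\in\mathrm{S}_F(n,d)$ is defined by $\xi_\Gamma f(S)=\sum_{\{T\mid\Gamma_{S,T}=\Gamma\}}f(T)$; the elements $\xi_\Gamma$, $\Gamma\in M(n,d)$, form a basis of $\mathrm{S}_F(n,d)$. Compatibility: for labellings $l,l_1,l_2$ of $\Gamma,\Gamma_1,\Gamma_2$, the pair $(l_1,l_2)$ is compatible with $l$ if for every $s\in[d]$, writing $l_1(s)=(i_1',j_1)$ and $l_2(s)=(i_2',j_2)$, one has $i_1=j_2$ and $l(s)=(i_2',j_1)$. *)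

theory Defs
  imports "HOL-Algebra.Module" "HOL-Computational_Algebra.Computational_Algebra"
    "HOL-Combinatorics.Permutations" "HOL-Library.Multiset"
    "HOL-Library.FuncSet" "HOL-Library.Disjoint_Sets"
begin

text \<open>
  Tuples, functions on a finite set, operators and labellings are all represented as
  extensional functions, so that HOL equality is equality on the intended domain and
  cardinalities of sets of such functions are the intended ones.
\<close>

definition set_tuples :: "nat \<Rightarrow> nat \<Rightarrow> (nat \<Rightarrow> nat set) set" where
  "set_tuples n d = {S \<in> {1..n} \<rightarrow>\<^sub>E Pow {1..d}.
     disjoint_family_on S {1..n} \<and> (\<Union>i\<in>{1..n}. S i) = {1..d}}"

definition tuple_act :: "nat \<Rightarrow> (nat \<Rightarrow> nat set) \<Rightarrow> (nat \<Rightarrow> nat) \<Rightarrow> nat \<Rightarrow> nat set" where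
  "tuple_act n S w = (\<lambda>i\<in>{1..n}. inv_into UNIV w ` S i)"

definition tuple_funs :: "nat \<Rightarrow> nat \<Rightarrow> ((nat \<Rightarrow> nat set) \<Rightarrow> 'f) set" where
  "tuple_funs n d = set_tuples n d \<rightarrow>\<^sub>E UNIV"

definition perm_rep ::
    "nat \<Rightarrow> nat \<Rightarrow> (nat \<Rightarrow> nat) \<Rightarrow> ((nat \<Rightarrow> nat set) \<Rightarrow> 'f) \<Rightarrow> (nat \<Rightarrow> nat set) \<Rightarrow> 'f" where
  "perm_rep n d w f = (\<lambda>S\<in>set_tuples n d. f (tuple_act n S w))"

definition fun_add ::
    "nat \<Rightarrow> nat \<Rightarrow> ((nat \<Rightarrow> nat set) \<Rightarrow> 'f::field) \<Rightarrow> ((nat \<Rightarrow> nat set) \<Rightarrow> 'f) \<Rightarrow> (nat \<Rightarrow> nat set) \<Rightarrow> 'f"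
  where "fun_add n d f g = (\<lambda>S\<in>set_tuples n d. f S + g S)"

definition fun_scale ::
    "nat \<Rightarrow> nat \<Rightarrow> 'f::field \<Rightarrow> ((nat \<Rightarrow> nat set) \<Rightarrow> 'f) \<Rightarrow> (nat \<Rightarrow> nat set) \<Rightarrow> 'f"
  where "fun_scale n d a f = (\<lambda>S\<in>set_tuples n d. a * f S)"

definition fun_zero :: "nat \<Rightarrow> nat \<Rightarrow> (nat \<Rightarrow> nat set) \<Rightarrow> 'f::field"
  where "fun_zero n d = (\<lambda>S\<in>set_tuples n d. 0)"

type_synonym 'f tuple_op = "((nat \<Rightarrow> nat set) \<Rightarrow> 'f) \<Rightarrow> (nat \<Rightarrow> nat set) \<Rightarrow> 'f"

definition equivariant_endos :: "nat \<Rightarrow> nat \<Rightarrow> 'f::field tuple_op set" where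
  "equivariant_endos n d = {\<phi> \<in> tuple_funs n d \<rightarrow>\<^sub>E tuple_funs n d.
     (\<forall>f\<in>tuple_funs n d. \<forall>g\<in>tuple_funs n d. \<phi> (fun_add n d f g) = fun_add n d (\<phi> f) (\<phi> g)) \<and>
     (\<forall>a. \<forall>f\<in>tuple_funs n d. \<phi> (fun_scale n d a f) = fun_scale n d a (\<phi> f)) \<and>
     (\<forall>w. w permutes {1..d} \<longrightarrow>
        (\<forall>f\<in>tuple_funs n d. \<phi> (perm_rep n d w f) = perm_rep n d w (\<phi> f)))}"

text \<open>
  The Schur algebra \<open>S\<^sub>F(n,d)\<close> in its realisation as the \<open>S\<^sub>d\<close>-equivariant
  endomorphisms of \<open>F[B(n,d)]\<close> (that is, \<open>tuple_funs n d\<close>), with composition as product.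
\<close>

definition schur_algebra :: "nat \<Rightarrow> nat \<Rightarrow> ('f::field, 'f tuple_op) module" where
  "schur_algebra n d =
     \<lparr>carrier = equivariant_endos n d,
      monoid.mult = (\<lambda>\<phi> \<psi>. compose (tuple_funs n d) \<phi> \<psi>),
      one = (\<lambda>f\<in>tuple_funs n d. f),
      zero = (\<lambda>f\<in>tuple_funs n d. fun_zero n d),
      add = (\<lambda>\<phi> \<psi>. \<lambda>f\<in>tuple_funs n d. fun_add n d (\<phi> f) (\<psi> f)),
      module.smult = (\<lambda>a \<phi>. \<lambda>f\<in>tuple_funs n d. fun_scale n d a (\<phi> f))\<rparr>"

text \<open>
  A bipartite multigraph with vertex set \<open>[n'] \<Coprod> [n]\<close> is the multiset of its edges; the
  pair \<open>(i, j)\<close> stands for the edge joining \<open>i'\<close> and \<open>j\<close>, so the first component is always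
  the primed vertex.
\<close>

definition multigraphs :: "nat \<Rightarrow> nat \<Rightarrow> (nat \<times> nat) multiset set" where
  "multigraphs n d = {\<Gamma>. set_mset \<Gamma> \<subseteq> {1..n} \<times> {1..n} \<and> size \<Gamma> = d}"

definition labellings :: "nat \<Rightarrow> nat \<Rightarrow> (nat \<times> nat) multiset \<Rightarrow> (nat \<Rightarrow> nat \<times> nat) set" where
  "labellings n d \<Gamma> = {l \<in> {1..d} \<rightarrow>\<^sub>E {1..n} \<times> {1..n}.
     \<forall>i\<in>{1..n}. \<forall>j\<in>{1..n}. card {s \<in> {1..d}. l s = (i, j)} = count \<Gamma> (i, j)}"

definition tuple_graph ::
    "nat \<Rightarrow> (nat \<Rightarrow> nat set) \<Rightarrow> (nat \<Rightarrow> nat set) \<Rightarrow> (nat \<times> nat) multiset" where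
  "tuple_graph n S T = (\<Sum>(i, j)\<in>{1..n} \<times> {1..n}. replicate_mset (card (S j \<inter> T i)) (i, j))"

definition xi :: "nat \<Rightarrow> nat \<Rightarrow> (nat \<times> nat) multiset \<Rightarrow> 'f::field tuple_op" where
  "xi n d \<Gamma> = (\<lambda>f\<in>tuple_funs n d. \<lambda>S\<in>set_tuples n d.
     \<Sum>T | T \<in> set_tuples n d \<and> tuple_graph n S T = \<Gamma>. f T)"

text \<open>
  The family \<open>c\<close> of coefficients is the unique one for which the defining equation holds;
  extensionality of \<open>c\<close> over the multigraphs makes the description pick a single HOL function.
\<close>

definition structure_constant ::
    "nat \<Rightarrow> nat \<Rightarrow> (nat \<times> nat) multiset \<Rightarrow> (nat \<times> nat) multiset \<Rightarrow> (nat \<times> nat) multiset \<Rightarrow> 'f::field"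
  where
  "structure_constant n d \<Gamma>1 \<Gamma>2 = (THE c. c \<in> multigraphs n d \<rightarrow>\<^sub>E UNIV \<and>
     xi n d \<Gamma>1 \<otimes>\<^bsub>schur_algebra n d\<^esub> xi n d \<Gamma>2 =
       (\<Oplus>\<^bsub>schur_algebra n d\<^esub>\<Gamma>\<in>multigraphs n d. c \<Gamma> \<odot>\<^bsub>schur_algebra n d\<^esub> xi n d \<Gamma>))"

definition compatible ::
    "nat \<Rightarrow> (nat \<Rightarrow> nat \<times> nat) \<Rightarrow> (nat \<Rightarrow> nat \<times> nat) \<Rightarrow> (nat \<Rightarrow> nat \<times> nat) \<Rightarrow> bool" where
  "compatible d l1 l2 l \<longleftrightarrow>
     (\<forall>s\<in>{1..d}. fst (l1 s) = snd (l2 s) \<and> l s = (fst (l2 s), snd (l1 s)))"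

end

theory Submission
  imports Defs
begin

text \<open>
  Evaluated at a function \<open>f\<close> and a tuple \<open>S\<close>, the product of \<open>\<xi>\<close> for \<open>\<Gamma>1\<close> and \<open>\<xi>\<close> for \<open>\<Gamma>2\<close> is
  the sum over all tuples \<open>U\<close> of \<open>f U\<close> weighted by the number of intermediate tuples \<open>T\<close> with
  \<open>\<Gamma>\<^bsub>S,T\<^esub> = \<Gamma>1\<close> and \<open>\<Gamma>\<^bsub>T,U\<^esub> = \<Gamma>2\<close>, whereas a linear combination of the \<open>\<xi>\<close>'s with coefficients
  \<open>c\<close> weights \<open>f U\<close> by \<open>c \<Gamma>\<^bsub>S,U\<^esub>\<close> (\<open>xi_mult_apply\<close>, \<open>xi_combination_apply\<close>). So the structure
  constant at \<open>\<Gamma>\<close> is the number of intermediate \<open>T\<close> for any \<open>S\<close>, \<open>U\<close> with \<open>\<Gamma>\<^bsub>S,U\<^esub> = \<Gamma>\<close>, provided that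
  this number depends on \<open>\<Gamma>\<close> alone; every \<open>\<Gamma>\<close> arises from some \<open>S\<close>, \<open>U\<close>, which makes the
  coefficients unique (\<open>xi_combination_inj\<close>).

  To count the tuples \<open>T\<close>, view a tuple of disjoint sets covering \<open>[d]\<close> as a colouring
  \<open>[d] \<rightarrow> [n]\<close>. If \<open>S\<close>, \<open>T\<close>, \<open>U\<close> have colourings \<open>b\<close>, \<open>t\<close>, \<open>a\<close>, then \<open>s \<mapsto> (t s, b s)\<close>,
  \<open>s \<mapsto> (a s, t s)\<close> and \<open>s \<mapsto> (a s, b s)\<close> are labellings of \<open>\<Gamma>\<^bsub>S,T\<^esub>\<close>, \<open>\<Gamma>\<^bsub>T,U\<^esub>\<close> and \<open>\<Gamma>\<^bsub>S,U\<^esub>\<close>,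
  and the first two are compatible with the third. Conversely, a pair compatible with the third
  is of this form for exactly one \<open>t\<close>. Hence the number of \<open>T\<close> is the number of pairs
  compatible with one particular labelling of \<open>\<Gamma>\<close> (\<open>card_intermediate_tuples\<close>). Finally, two
  labellings of \<open>\<Gamma>\<close> differ by a permutation of \<open>[d]\<close>, and composing with it carries compatible
  pairs to compatible pairs, so the choice of labelling is irrelevant
  (\<open>card_compatible_pairs_le\<close>).
\<close>

section \<open>Tuples of sets as colourings\<close>

text \<open>
  The tuple of fibres of a colouring \<open>a\<close> of \<open>[d]\<close>, extensional in the colour so that it can be
  a member of \<open>set_tuples n d\<close>.
\<close>
definition colour_classes :: "nat \<Rightarrow> nat \<Rightarrow> (nat \<Rightarrow> nat) \<Rightarrow> nat \<Rightarrow> nat set" where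
  "colour_classes n d a = (\<lambda>i\<in>{1..n}. {s \<in> {1..d}. a s = i})"

lemma finite_set_tuples [simp]: "finite (set_tuples n d)"
  unfolding set_tuples_def
  by (rule finite_subset[of _ "{1..n} \<rightarrow>\<^sub>E Pow {1..d}"]) (auto intro: finite_PiE)

lemma finite_multigraphs [simp]: "finite (multigraphs n d)"
proof -
  have "multigraphs n d \<subseteq> mset ` {xs. set xs \<subseteq> {1..n} \<times> {1..n} \<and> length xs = d}"
  proof
    fix \<Gamma> assume \<Gamma>: "\<Gamma> \<in> multigraphs n d"
    obtain xs where xs: "mset xs = \<Gamma>" by (metis ex_mset)
    have "set xs \<subseteq> {1..n} \<times> {1..n}" "length xs = d"
      using \<Gamma> unfolding multigraphs_def xs[symmetric] by auto
    then show "\<Gamma> \<in> mset ` {xs. set xs \<subseteq> {1..n} \<times> {1..n} \<and> length xs = d}"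
      using xs by blast
  qed
  then show ?thesis
    by (rule finite_subset) (intro finite_imageI finite_lists_length_eq finite_cartesian_product finite_atLeastAtMost)
qed

lemma colour_classes_in_set_tuples:
  assumes "a \<in> {1..d} \<rightarrow>\<^sub>E {1..n}"
  shows "colour_classes n d a \<in> set_tuples n d"
  unfolding set_tuples_def mem_Collect_eq
proof (intro conjI)
  show "colour_classes n d a \<in> {1..n} \<rightarrow>\<^sub>E Pow {1..d}"
    unfolding colour_classes_def by auto
  show "disjoint_family_on (colour_classes n d a) {1..n}"
    unfolding colour_classes_def disjoint_family_on_def by auto
  show "(\<Union>i\<in>{1..n}. colour_classes n d a i) = {1..d}"
    unfolding colour_classes_def using PiE_mem[OF assms] by auto
qed

lemma bij_betw_colour_classes:
  "bij_betw (colour_classes n d) ({1..d} \<rightarrow>\<^sub>E {1..n}) (set_tuples n d)"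
  unfolding bij_betw_def
proof
  show "inj_on (colour_classes n d) ({1..d} \<rightarrow>\<^sub>E {1..n})"
  proof (rule inj_onI)
    fix a b
    assume a: "a \<in> {1..d} \<rightarrow>\<^sub>E {1..n}" and b: "b \<in> {1..d} \<rightarrow>\<^sub>E {1..n}"
      and eq: "colour_classes n d a = colour_classes n d b"
    show "a = b"
    proof (rule PiE_ext[OF a b])
      fix s assume s: "s \<in> {1..d}"
      have "a s \<in> {1..n}" using a s by blast
      moreover have "s \<in> colour_classes n d a (a s)"
        using s calculation by (simp add: colour_classes_def)
      ultimately show "a s = b s"
        unfolding eq by (simp add: colour_classes_def)
    qed
  qed
  show "colour_classes n d ` ({1..d} \<rightarrow>\<^sub>E {1..n}) = set_tuples n d"
  proof
    show "colour_classes n d ` ({1..d} \<rightarrow>\<^sub>E {1..n}) \<subseteq> set_tuples n d"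
      using colour_classes_in_set_tuples by blast
    show "set_tuples n d \<subseteq> colour_classes n d ` ({1..d} \<rightarrow>\<^sub>E {1..n})"
    proof
      fix S assume "S \<in> set_tuples n d"
      then have S: "S \<in> {1..n} \<rightarrow>\<^sub>E Pow {1..d}" and disj: "disjoint_family_on S {1..n}"
        and un: "(\<Union>i\<in>{1..n}. S i) = {1..d}"
        unfolding set_tuples_def by auto
      have "\<forall>s\<in>{1..d}. \<exists>i. i \<in> {1..n} \<and> s \<in> S i" using un by blast
      then obtain a where a: "\<And>s. s \<in> {1..d} \<Longrightarrow> a s \<in> {1..n} \<and> s \<in> S (a s)"
        by metis
      let ?a = "restrict a {1..d}"
      have mem: "?a \<in> {1..d} \<rightarrow>\<^sub>E {1..n}" using a by auto
      have "colour_classes n d ?a = S"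
      proof (rule PiE_ext[of _ "{1..n}" "\<lambda>_. Pow {1..d}"])
        show "colour_classes n d ?a \<in> {1..n} \<rightarrow>\<^sub>E Pow {1..d}"
          unfolding colour_classes_def by auto
        show "S \<in> {1..n} \<rightarrow>\<^sub>E Pow {1..d}" by (rule S)
        fix i assume i: "i \<in> {1..n}"
        have "s \<in> S i \<longleftrightarrow> s \<in> {1..d} \<and> a s = i" for s
        proof
          assume s: "s \<in> S i"
          then have sd: "s \<in> {1..d}" using un i by blast
          have "a s = i"
          proof (rule ccontr)
            assume "a s \<noteq> i"
            then have "S (a s) \<inter> S i = {}"
              using disj a[OF sd] i unfolding disjoint_family_on_def by blast
            then show False using a[OF sd] s by blast
          qed
          with sd show "s \<in> {1..d} \<and> a s = i" ..
        next
          assume "s \<in> {1..d} \<and> a s = i"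
          then show "s \<in> S i" using a by blast
        qed
        then show "colour_classes n d ?a i = S i"
          using i by (auto simp: colour_classes_def)
      qed
      with mem show "S \<in> colour_classes n d ` ({1..d} \<rightarrow>\<^sub>E {1..n})" by blast
    qed
  qed
qed

section \<open>Labellings as enumerations of edges\<close>

text \<open>The multiset of values of \<open>l\<close> on \<open>[d]\<close>: the only multigraph that \<open>l\<close> can label.\<close>
definition edge_mset :: "nat \<Rightarrow> (nat \<Rightarrow> nat \<times> nat) \<Rightarrow> (nat \<times> nat) multiset" where
  "edge_mset d l = image_mset l (mset_set {1..d})"

lemma count_edge_mset: "count (edge_mset d l) e = card {s \<in> {1..d}. l s = e}"
  unfolding edge_mset_def count_image_mset
  by (auto simp: vimage_def Int_def intro!: arg_cong[of _ _ card])

lemma edge_mset_cong: "(\<And>s. s \<in> {1..d} \<Longrightarrow> l s = l' s) \<Longrightarrow> edge_mset d l = edge_mset d l'"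
  unfolding edge_mset_def by (rule image_mset_cong) simp

lemma edge_mset_permute:
  assumes "w permutes {1..d}"
  shows "edge_mset d (l \<circ> w) = edge_mset d l"
  unfolding edge_mset_def multiset.map_comp[symmetric]
    image_mset_mset_set[OF permutes_inj_on[OF assms]] permutes_image[OF assms] ..

lemma edge_mset_in_multigraphs:
  "l \<in> {1..d} \<rightarrow> {1..n} \<times> {1..n} \<Longrightarrow> edge_mset d l \<in> multigraphs n d"
  using funcset_image[of l "{1..d}" "{1..n} \<times> {1..n}"]
  unfolding multigraphs_def edge_mset_def by simp

text \<open>
  The definition of a labelling only compares multiplicities at pairs in \<open>[n] \<times> [n]\<close>. Outside,
  both multiplicities vanish, so it amounts to an equality of multisets.
\<close>
lemma labellings_iff:
  assumes "\<Gamma> \<in> multigraphs n d"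
  shows "l \<in> labellings n d \<Gamma> \<longleftrightarrow> l \<in> {1..d} \<rightarrow>\<^sub>E {1..n} \<times> {1..n} \<and> edge_mset d l = \<Gamma>"
proof (cases "l \<in> {1..d} \<rightarrow>\<^sub>E {1..n} \<times> {1..n}")
  case True
  have out: "count (edge_mset d l) e = count \<Gamma> e" if "e \<notin> {1..n} \<times> {1..n}" for e
  proof -
    have "edge_mset d l \<in> multigraphs n d"
      using True by (intro edge_mset_in_multigraphs) auto
    then show ?thesis
      using assms that unfolding multigraphs_def by (metis (no_types, lifting) mem_Collect_eq not_in_iff subsetD)
  qed
  have "edge_mset d l = \<Gamma> \<longleftrightarrow> (\<forall>e\<in>{1..n} \<times> {1..n}. count (edge_mset d l) e = count \<Gamma> e)"
    using out unfolding multiset_eq_iff by blast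
  with True show ?thesis
    unfolding labellings_def mem_Collect_eq count_edge_mset by blast
qed (simp add: labellings_def)

lemma labellings_nonempty:
  assumes "\<Gamma> \<in> multigraphs n d"
  obtains l where "l \<in> labellings n d \<Gamma>"
proof -
  obtain xs where xs: "mset xs = \<Gamma>" by (metis ex_mset)
  have len: "length xs = d" and sub: "set xs \<subseteq> {1..n} \<times> {1..n}"
    using assms unfolding multigraphs_def xs[symmetric] by auto
  let ?l = "\<lambda>s\<in>{1..d}. xs ! (s - 1)"
  have "edge_mset d ?l = image_mset (\<lambda>s. xs ! (s - 1)) (mset_set {1..d})"
    unfolding edge_mset_def by (rule image_mset_cong) simp
  also have "mset_set {1..d} = mset_set (Suc ` {0..<d})"
    by (simp add: image_Suc_atLeastLessThan atLeastLessThanSuc_atLeastAtMost)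
  also have "image_mset (\<lambda>s. xs ! (s - 1)) (mset_set (Suc ` {0..<d})) =
      image_mset (\<lambda>s. xs ! (s - 1)) (image_mset Suc (mset_set {0..<d}))"
    by (subst image_mset_mset_set) auto
  also have "\<dots> = image_mset (\<lambda>s. xs ! s) (mset_set {0..<d})"
    by (simp add: multiset.map_comp o_def)
  also have "\<dots> = mset (map ((!) xs) [0..<length xs])"
    by (simp add: len)
  also have "\<dots> = \<Gamma>" by (simp only: map_nth xs)
  finally have "edge_mset d ?l = \<Gamma>" .
  moreover have "?l \<in> {1..d} \<rightarrow>\<^sub>E {1..n} \<times> {1..n}"
  proof (intro restrict_PiE_iff[THEN iffD2] ballI)
    fix s assume "s \<in> {1..d}"
    then have "s - 1 < length xs" using len by auto
    then show "xs ! (s - 1) \<in> {1..n} \<times> {1..n}" using sub nth_mem by blast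
  qed
  ultimately show thesis using that labellings_iff[OF assms] by blast
qed

lemma count_tuple_graph:
  "count (tuple_graph n S T) (i, j) =
     (if i \<in> {1..n} \<and> j \<in> {1..n} then card (S j \<inter> T i) else 0)"
proof -
  have "count (tuple_graph n S T) (i, j) =
      (\<Sum>e\<in>{1..n} \<times> {1..n}. if (i, j) = e then card (S j \<inter> T i) else 0)"
    unfolding tuple_graph_def count_sum
    by (rule sum.cong) (auto split: prod.splits)
  then show ?thesis
    by (auto simp: sum.delta)
qed

text \<open>
  The first component of an edge is the primed vertex, which records the second tuple; hence the
  swap of \<open>a\<close> and \<open>b\<close>.
\<close>
lemma tuple_graph_colour_classes:
  assumes "a \<in> {1..d} \<rightarrow>\<^sub>E {1..n}" "b \<in> {1..d} \<rightarrow>\<^sub>E {1..n}"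
  shows "tuple_graph n (colour_classes n d b) (colour_classes n d a) = edge_mset d (\<lambda>s. (a s, b s))"
proof (rule multiset_eqI)
  fix e :: "nat \<times> nat"
  obtain i j where e: "e = (i, j)" by (cases e)
  show "count (tuple_graph n (colour_classes n d b) (colour_classes n d a)) e =
      count (edge_mset d (\<lambda>s. (a s, b s))) e"
  proof (cases "i \<in> {1..n} \<and> j \<in> {1..n}")
    case True
    then show ?thesis
      unfolding e count_tuple_graph count_edge_mset colour_classes_def
      by (auto intro!: arg_cong[of _ _ card])
  next
    case False
    have "{s \<in> {1..d}. (a s, b s) = (i, j)} = {}"
      using False PiE_mem[OF assms(1)] PiE_mem[OF assms(2)] by blast
    with False show ?thesis
      unfolding e count_tuple_graph count_edge_mset by (simp only: card.empty if_False)
  qed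
qed

lemma tuple_graph_in_multigraphs:
  assumes "S \<in> set_tuples n d" "T \<in> set_tuples n d"
  shows "tuple_graph n S T \<in> multigraphs n d"
proof -
  obtain a b where a: "a \<in> {1..d} \<rightarrow>\<^sub>E {1..n}" and b: "b \<in> {1..d} \<rightarrow>\<^sub>E {1..n}"
    and ST: "S = colour_classes n d b" "T = colour_classes n d a"
    using assms unfolding bij_betw_imp_surj_on[OF bij_betw_colour_classes, symmetric] by blast
  have "(\<lambda>s. (a s, b s)) \<in> {1..d} \<rightarrow> {1..n} \<times> {1..n}"
    using a b by blast
  then show ?thesis
    unfolding ST tuple_graph_colour_classes[OF a b] by (rule edge_mset_in_multigraphs)
qed

lemma multigraph_is_tuple_graph:
  assumes "\<Gamma> \<in> multigraphs n d"
  obtains S T where "S \<in> set_tuples n d" "T \<in> set_tuples n d" "tuple_graph n S T = \<Gamma>"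
proof -
  obtain l where "l \<in> labellings n d \<Gamma>" using labellings_nonempty[OF assms] .
  then have l: "l \<in> {1..d} \<rightarrow>\<^sub>E {1..n} \<times> {1..n}" and \<Gamma>: "edge_mset d l = \<Gamma>"
    using labellings_iff[OF assms] by auto
  let ?a = "\<lambda>s\<in>{1..d}. fst (l s)" and ?b = "\<lambda>s\<in>{1..d}. snd (l s)"
  have a: "?a \<in> {1..d} \<rightarrow>\<^sub>E {1..n}" and b: "?b \<in> {1..d} \<rightarrow>\<^sub>E {1..n}"
    using PiE_mem[OF l] by (auto simp: mem_Times_iff)
  have "tuple_graph n (colour_classes n d ?b) (colour_classes n d ?a) = \<Gamma>"
    unfolding tuple_graph_colour_classes[OF a b] \<Gamma>[symmetric] by (rule edge_mset_cong) simp
  then show thesis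
    using that colour_classes_in_set_tuples[OF a] colour_classes_in_set_tuples[OF b] by blast
qed

section \<open>Counting intermediate tuples\<close>

text \<open>The pairs of labellings of \<open>\<Gamma>1\<close> and \<open>\<Gamma>2\<close> that are compatible with \<open>l\<close>.\<close>
definition compatible_pairs where
  "compatible_pairs n d \<Gamma>1 \<Gamma>2 l =
     {(l1, l2). l1 \<in> labellings n d \<Gamma>1 \<and> l2 \<in> labellings n d \<Gamma>2 \<and> compatible d l1 l2 l}"

lemma labellings_permute:
  assumes "\<Gamma> \<in> multigraphs n d" "w permutes {1..d}" "l \<in> labellings n d \<Gamma>"
  shows "restrict (l \<circ> w) {1..d} \<in> labellings n d \<Gamma>"
proof -
  have "edge_mset d (restrict (l \<circ> w) {1..d}) = edge_mset d (l \<circ> w)"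
    by (rule edge_mset_cong) simp
  moreover have "restrict (l \<circ> w) {1..d} \<in> {1..d} \<rightarrow>\<^sub>E {1..n} \<times> {1..n}"
  proof (intro restrict_PiE_iff[THEN iffD2] ballI)
    fix s assume "s \<in> {1..d}"
    then have "w s \<in> {1..d}" using permutes_in_image[OF assms(2)] by blast
    then show "(l \<circ> w) s \<in> {1..n} \<times> {1..n}"
      using assms(3) PiE_mem unfolding labellings_def o_def by blast
  qed
  ultimately show ?thesis
    using assms edge_mset_permute[OF assms(2), of l] by (simp add: labellings_iff)
qed

lemma finite_compatible_pairs: "finite (compatible_pairs n d \<Gamma>1 \<Gamma>2 l)"
proof (rule finite_subset)
  let ?P = "{1..d} \<rightarrow>\<^sub>E {1..n} \<times> {1..n}"
  show "compatible_pairs n d \<Gamma>1 \<Gamma>2 l \<subseteq> ?P \<times> ?P"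
    unfolding compatible_pairs_def labellings_def by blast
  show "finite (?P \<times> ?P)" by (intro finite_cartesian_product finite_PiE) auto
qed

text \<open>
  By symmetry in \<open>l\<close> and \<open>l'\<close> the two cardinalities are equal. The injection is composition with
  a permutation \<open>w\<close> of \<open>[d]\<close> such that \<open>l' = l \<circ> w\<close>, which exists because \<open>l\<close> and \<open>l'\<close> take each
  value equally often.
\<close>
lemma card_compatible_pairs_le:
  assumes \<Gamma>: "\<Gamma> \<in> multigraphs n d" "\<Gamma>1 \<in> multigraphs n d" "\<Gamma>2 \<in> multigraphs n d"
    and l: "l \<in> labellings n d \<Gamma>" "l' \<in> labellings n d \<Gamma>"
  shows "card (compatible_pairs n d \<Gamma>1 \<Gamma>2 l) \<le> card (compatible_pairs n d \<Gamma>1 \<Gamma>2 l')"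
proof -
  have "image_mset l' (mset_set {1..d}) = image_mset l (mset_set {1..d})"
    using l \<Gamma>(1) by (simp add: labellings_iff edge_mset_def)
  then obtain w where w: "w permutes {1..d}" and l': "\<forall>s\<in>{1..d}. l' s = l (w s)"
    using image_mset_eq_implies_permutes[of "{1..d}" l' l] by auto
  let ?g = "\<lambda>m. restrict (m \<circ> w) {1..d}"
  have inj: "m = m'" if "?g m = ?g m'" "m \<in> labellings n d \<Delta>" "m' \<in> labellings n d \<Delta>" for m m' \<Delta>
  proof -
    have m: "m \<in> {1..d} \<rightarrow>\<^sub>E {1..n} \<times> {1..n}" "m' \<in> {1..d} \<rightarrow>\<^sub>E {1..n} \<times> {1..n}"
      using that unfolding labellings_def by auto
    show ?thesis
    proof (rule PiE_ext[OF m])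
      fix s assume "s \<in> {1..d}"
      then obtain t where t: "t \<in> {1..d}" "s = w t"
        using permutes_image[OF w] by blast
      then show "m s = m' s" using fun_cong[OF that(1), of t] by simp
    qed
  qed
  have "inj_on (map_prod ?g ?g) (compatible_pairs n d \<Gamma>1 \<Gamma>2 l)"
  proof (rule inj_onI)
    fix p q
    assume "p \<in> compatible_pairs n d \<Gamma>1 \<Gamma>2 l" "q \<in> compatible_pairs n d \<Gamma>1 \<Gamma>2 l"
      and "map_prod ?g ?g p = map_prod ?g ?g q"
    then show "p = q"
      using inj[of "fst p" "fst q" \<Gamma>1] inj[of "snd p" "snd q" \<Gamma>2]
      unfolding compatible_pairs_def prod_eq_iff
      by (simp only: fst_map_prod snd_map_prod mem_Collect_eq case_prod_beta)
  qed
  moreover have "map_prod ?g ?g ` compatible_pairs n d \<Gamma>1 \<Gamma>2 l \<subseteq> compatible_pairs n d \<Gamma>1 \<Gamma>2 l'"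
  proof (rule image_subsetI)
    fix p assume "p \<in> compatible_pairs n d \<Gamma>1 \<Gamma>2 l"
    then obtain l1 l2 where p: "p = (l1, l2)" and L: "l1 \<in> labellings n d \<Gamma>1" "l2 \<in> labellings n d \<Gamma>2" and c: "compatible d l1 l2 l"
      unfolding compatible_pairs_def by auto
    have "compatible d (?g l1) (?g l2) l'"
      using c l' permutes_in_image[OF w] unfolding compatible_def by simp
    then show "map_prod ?g ?g p \<in> compatible_pairs n d \<Gamma>1 \<Gamma>2 l'"
      using labellings_permute[OF \<Gamma>(2) w L(1)] labellings_permute[OF \<Gamma>(3) w L(2)]
      by (simp add: compatible_pairs_def p)
  qed
  ultimately show ?thesis by (rule card_inj_on_le[OF _ _ finite_compatible_pairs])
qed

lemma card_intermediate_tuples: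
  assumes \<Gamma>: "\<Gamma> \<in> multigraphs n d" "\<Gamma>1 \<in> multigraphs n d" "\<Gamma>2 \<in> multigraphs n d"
    and l: "l \<in> labellings n d \<Gamma>"
    and S: "S \<in> set_tuples n d" and U: "U \<in> set_tuples n d" and SU: "tuple_graph n S U = \<Gamma>"
  shows "card {T \<in> set_tuples n d. tuple_graph n S T = \<Gamma>1 \<and> tuple_graph n T U = \<Gamma>2} =
    card (compatible_pairs n d \<Gamma>1 \<Gamma>2 l)"
proof -
  obtain a b where a: "a \<in> {1..d} \<rightarrow>\<^sub>E {1..n}" and b: "b \<in> {1..d} \<rightarrow>\<^sub>E {1..n}"
    and Sb: "S = colour_classes n d b" and Ua: "U = colour_classes n d a"
    using S U unfolding bij_betw_imp_surj_on[OF bij_betw_colour_classes, symmetric] by blast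
  \<comment> \<open>\<open>pr x y\<close> labels the graph of the tuples with colourings \<open>y\<close> and \<open>x\<close>, in this order.\<close>
  define pr where "pr = (\<lambda>(x :: nat \<Rightarrow> nat) (y :: nat \<Rightarrow> nat). \<lambda>s\<in>{1..d}. (x s, y s))"
  have pr_lab: "pr x y \<in> labellings n d \<Delta> \<longleftrightarrow>
      tuple_graph n (colour_classes n d y) (colour_classes n d x) = \<Delta>"
    if "x \<in> {1..d} \<rightarrow>\<^sub>E {1..n}" "y \<in> {1..d} \<rightarrow>\<^sub>E {1..n}" "\<Delta> \<in> multigraphs n d" for x y \<Delta>
  proof -
    have "edge_mset d (pr x y) = edge_mset d (\<lambda>s. (x s, y s))"
      unfolding pr_def by (rule edge_mset_cong) simp
    moreover have "pr x y \<in> {1..d} \<rightarrow>\<^sub>E {1..n} \<times> {1..n}"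
      unfolding pr_def using PiE_mem[OF that(1)] PiE_mem[OF that(2)] by auto
    ultimately show ?thesis
      using that by (simp add: labellings_iff tuple_graph_colour_classes)
  qed
  have l0: "pr a b \<in> labellings n d \<Gamma>" using pr_lab[OF a b \<Gamma>(1)] SU Sb Ua by simp
  let ?C = "{t \<in> {1..d} \<rightarrow>\<^sub>E {1..n}. pr t b \<in> labellings n d \<Gamma>1 \<and> pr a t \<in> labellings n d \<Gamma>2}"
  have tuples: "{T \<in> set_tuples n d. tuple_graph n S T = \<Gamma>1 \<and> tuple_graph n T U = \<Gamma>2} =
      colour_classes n d ` ?C"
    unfolding bij_betw_imp_surj_on[OF bij_betw_colour_classes, symmetric] Sb Ua
    using pr_lab[OF _ b \<Gamma>(2)] pr_lab[OF a _ \<Gamma>(3)] by auto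
  have "card {T \<in> set_tuples n d. tuple_graph n S T = \<Gamma>1 \<and> tuple_graph n T U = \<Gamma>2} = card ?C"
    unfolding tuples
    by (rule card_image, rule inj_on_subset[OF bij_betw_imp_inj_on[OF bij_betw_colour_classes]]) (rule Collect_restrict)
  also have "\<dots> = card (compatible_pairs n d \<Gamma>1 \<Gamma>2 (pr a b))"
  proof (rule bij_betw_same_card)
    show "bij_betw (\<lambda>t. (pr t b, pr a t)) ?C (compatible_pairs n d \<Gamma>1 \<Gamma>2 (pr a b))"
      unfolding bij_betw_def
    proof
      show "inj_on (\<lambda>t. (pr t b, pr a t)) ?C"
      proof (rule inj_onI)
        fix t u assume t: "t \<in> ?C" and u: "u \<in> ?C" and eq: "(pr t b, pr a t) = (pr u b, pr a u)"
        have t': "t \<in> {1..d} \<rightarrow>\<^sub>E {1..n}" and u': "u \<in> {1..d} \<rightarrow>\<^sub>E {1..n}"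
          using t u by (simp_all only: mem_Collect_eq)
        show "t = u"
        proof (rule PiE_ext[OF t' u'])
          fix s assume "s \<in> {1..d}"
          moreover have "pr t b s = pr u b s" using eq by simp
          ultimately show "t s = u s" by (simp add: pr_def)
        qed
      qed
      show "(\<lambda>t. (pr t b, pr a t)) ` ?C = compatible_pairs n d \<Gamma>1 \<Gamma>2 (pr a b)"
      proof
        show "(\<lambda>t. (pr t b, pr a t)) ` ?C \<subseteq> compatible_pairs n d \<Gamma>1 \<Gamma>2 (pr a b)"
          unfolding compatible_pairs_def compatible_def by (auto simp: pr_def)
        show "compatible_pairs n d \<Gamma>1 \<Gamma>2 (pr a b) \<subseteq> (\<lambda>t. (pr t b, pr a t)) ` ?C"
        proof clarify
          fix l1 l2 assume "(l1, l2) \<in> compatible_pairs n d \<Gamma>1 \<Gamma>2 (pr a b)"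
          then have L1: "l1 \<in> labellings n d \<Gamma>1" and L2: "l2 \<in> labellings n d \<Gamma>2"
            and c: "\<And>s. s \<in> {1..d} \<Longrightarrow> fst (l1 s) = snd (l2 s) \<and> (a s, b s) = (fst (l2 s), snd (l1 s))"
            unfolding compatible_pairs_def compatible_def by (auto simp: pr_def)
          have P1: "l1 \<in> {1..d} \<rightarrow>\<^sub>E {1..n} \<times> {1..n}" and P2: "l2 \<in> {1..d} \<rightarrow>\<^sub>E {1..n} \<times> {1..n}"
            using L1 L2 unfolding labellings_def by auto
          \<comment> \<open>The intermediate colouring is the component that \<open>l1\<close> and \<open>l2\<close> share.\<close>
          define t where "t = (\<lambda>s\<in>{1..d}. fst (l1 s))"
          have t: "t \<in> {1..d} \<rightarrow>\<^sub>E {1..n}"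
            using PiE_mem[OF P1] unfolding t_def by (auto simp: mem_Times_iff)
          have "l1 = pr t b"
          proof
            fix s show "l1 s = pr t b s"
              using c[of s] PiE_arb[OF P1, of s] by (auto simp: pr_def t_def prod_eq_iff)
          qed
          moreover have "l2 = pr a t"
          proof
            fix s show "l2 s = pr a t s"
              using c[of s] PiE_arb[OF P2, of s] by (auto simp: pr_def t_def prod_eq_iff)
          qed
          ultimately show "(l1, l2) \<in> (\<lambda>t. (pr t b, pr a t)) ` ?C"
            using t L1 L2 by blast
        qed
      qed
    qed
  qed
  also have "\<dots> = card (compatible_pairs n d \<Gamma>1 \<Gamma>2 l)"
    using card_compatible_pairs_le[OF \<Gamma> l0 l] card_compatible_pairs_le[OF \<Gamma> l l0] by simp
  finally show ?thesis .
qed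

section \<open>Finite sums and standard elements in the Schur algebra\<close>

text \<open>
  The Schur algebra is shown to be an abelian monoid under addition, containing the \<open>\<xi>\<close>'s and
  closed under scalar multiplication; this is what allows finite sums in it to be evaluated
  pointwise.
\<close>

lemma tuple_act_in_set_tuples:
  assumes w: "w permutes {1..d}" and S: "S \<in> set_tuples n d"
  shows "tuple_act n S w \<in> set_tuples n d"
proof -
  let ?v = "inv_into UNIV w"
  have v: "?v permutes {1..d}" using permutes_inv[OF w] .
  have S1: "S \<in> {1..n} \<rightarrow>\<^sub>E Pow {1..d}" and disj: "disjoint_family_on S {1..n}"
    and un: "(\<Union>i\<in>{1..n}. S i) = {1..d}"
    using S unfolding set_tuples_def by auto
  have "(\<Union>i\<in>{1..n}. tuple_act n S w i) = ?v ` (\<Union>i\<in>{1..n}. S i)"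
    unfolding tuple_act_def by auto
  then have un': "(\<Union>i\<in>{1..n}. tuple_act n S w i) = {1..d}"
    using un permutes_image[OF v] by simp
  moreover have "disjoint_family_on (tuple_act n S w) {1..n}"
    unfolding disjoint_family_on_def tuple_act_def
    using disj by (simp add: disjoint_family_on_def image_Int[OF permutes_inj[OF v], symmetric])
  moreover have "tuple_act n S w \<in> {1..n} \<rightarrow>\<^sub>E Pow {1..d}"
    using un' by (auto simp: tuple_act_def PiE_iff)
  ultimately show ?thesis unfolding set_tuples_def by blast
qed

lemma tuple_act_inv:
  assumes w: "w permutes {1..d}" and S: "S \<in> set_tuples n d"
  shows "tuple_act n (tuple_act n S w) (inv_into UNIV w) = S"
    and "tuple_act n (tuple_act n S (inv_into UNIV w)) w = S"
proof -
  have "S \<in> extensional {1..n}" using S unfolding set_tuples_def PiE_def by blast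
  moreover have "inv_into UNIV (inv_into UNIV w) = w" using permutes_inv_inv[OF w] .
  ultimately show "tuple_act n (tuple_act n S w) (inv_into UNIV w) = S"
    "tuple_act n (tuple_act n S (inv_into UNIV w)) w = S"
    by (auto simp: tuple_act_def fun_eq_iff image_image extensional_def permutes_inverses[OF w])
qed

lemma bij_betw_tuple_act:
  assumes w: "w permutes {1..d}"
  shows "bij_betw (\<lambda>S. tuple_act n S w) (set_tuples n d) (set_tuples n d)"
  by (rule bij_betw_byWitness[of _ "\<lambda>S. tuple_act n S (inv_into UNIV w)"])
    (auto simp: tuple_act_inv[OF w] tuple_act_in_set_tuples[OF w]
      tuple_act_in_set_tuples[OF permutes_inv[OF w]])

lemma tuple_graph_act:
  assumes w: "w permutes {1..d}"
  shows "tuple_graph n (tuple_act n S w) (tuple_act n T w) = tuple_graph n S T"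
proof (rule multiset_eqI, clarify)
  fix i j
  have inj: "inj (inv_into UNIV w)" using permutes_inj[OF permutes_inv[OF w]] .
  show "count (tuple_graph n (tuple_act n S w) (tuple_act n T w)) (i, j) = count (tuple_graph n S T) (i, j)"
    by (simp add: count_tuple_graph tuple_act_def image_Int[OF inj, symmetric]
        card_image[OF inj_on_subset[OF inj subset_UNIV]])
qed

lemma fun_add_closed [simp]: "fun_add n d f g \<in> tuple_funs n d"
  and fun_scale_closed [simp]: "fun_scale n d a f \<in> tuple_funs n d"
  and fun_zero_closed [simp]: "fun_zero n d \<in> tuple_funs n d"
  and perm_rep_closed [simp]: "perm_rep n d w f \<in> tuple_funs n d"
  and xi_closed [simp]: "f \<in> tuple_funs n d \<Longrightarrow> xi n d \<Gamma> f \<in> tuple_funs n d"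
  by (auto simp: fun_add_def fun_scale_def fun_zero_def perm_rep_def tuple_funs_def xi_def)

lemma tuple_funs_eqI:
  "f \<in> tuple_funs n d \<Longrightarrow> g \<in> tuple_funs n d \<Longrightarrow> (\<And>S. S \<in> set_tuples n d \<Longrightarrow> f S = g S) \<Longrightarrow> f = g"
  unfolding tuple_funs_def by (rule PiE_ext)

lemma xi_apply:
  "f \<in> tuple_funs n d \<Longrightarrow> S \<in> set_tuples n d \<Longrightarrow>
    xi n d \<Gamma> f S = (\<Sum>T\<in>set_tuples n d. if tuple_graph n S T = \<Gamma> then f T else 0)"
  by (simp add: xi_def sum.If_cases Int_def)

text \<open>Substitute \<open>T \<mapsto> T \<cdot> w\<close> in the sum defining \<open>\<xi>\<close>; the action preserves \<open>\<Gamma>\<^bsub>S,T\<^esub>\<close>.\<close>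
lemma xi_equivariant:
  assumes w: "w permutes {1..d}" and f: "f \<in> tuple_funs n d"
  shows "xi n d \<Gamma> (perm_rep n d w f) = perm_rep n d w (xi n d \<Gamma> f)"
proof (rule tuple_funs_eqI)
  fix S assume S: "S \<in> set_tuples n d"
  have "xi n d \<Gamma> (perm_rep n d w f) S =
      (\<Sum>T\<in>set_tuples n d. if tuple_graph n (tuple_act n S w) (tuple_act n T w) = \<Gamma>
        then f (tuple_act n T w) else 0)"
    unfolding xi_apply[OF perm_rep_closed S] tuple_graph_act[OF w]
    by (rule sum.cong) (simp_all add: perm_rep_def)
  also have "\<dots> = (\<Sum>T\<in>set_tuples n d. if tuple_graph n (tuple_act n S w) T = \<Gamma> then f T else 0)"
    by (rule sum.reindex_bij_betw[OF bij_betw_tuple_act[OF w]])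
  also have "\<dots> = perm_rep n d w (xi n d \<Gamma> f) S"
    using S f tuple_act_in_set_tuples[OF w S] by (simp add: xi_apply perm_rep_def)
  finally show "xi n d \<Gamma> (perm_rep n d w f) S = perm_rep n d w (xi n d \<Gamma> f) S" .
qed (use f in simp_all)

lemma xi_in_equivariant_endos: "xi n d \<Gamma> \<in> equivariant_endos n d"
proof -
  have "xi n d \<Gamma> \<in> tuple_funs n d \<rightarrow>\<^sub>E tuple_funs n d"
    unfolding PiE_iff by (auto simp: xi_def[of n d \<Gamma>] simp del: xi_closed) (simp add: tuple_funs_def)
  moreover have "xi n d \<Gamma> (fun_add n d f g) = fun_add n d (xi n d \<Gamma> f) (xi n d \<Gamma> g)"
    if f: "f \<in> tuple_funs n d" and g: "g \<in> tuple_funs n d" for f g :: "(nat \<Rightarrow> nat set) \<Rightarrow> 'a"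
  proof (rule tuple_funs_eqI)
    fix S assume S: "S \<in> set_tuples n d"
    show "xi n d \<Gamma> (fun_add n d f g) S = fun_add n d (xi n d \<Gamma> f) (xi n d \<Gamma> g) S"
      using S f g by (auto simp: xi_apply) (auto simp: fun_add_def xi_apply sum.distrib[symmetric] intro!: sum.cong)
  qed (use f in simp_all)
  moreover have "xi n d \<Gamma> (fun_scale n d a f) = fun_scale n d a (xi n d \<Gamma> f)"
    if f: "f \<in> tuple_funs n d" for f :: "(nat \<Rightarrow> nat set) \<Rightarrow> 'a" and a
  proof (rule tuple_funs_eqI)
    fix S assume S: "S \<in> set_tuples n d"
    show "xi n d \<Gamma> (fun_scale n d a f) S = fun_scale n d a (xi n d \<Gamma> f) S"
      using S f by (auto simp: xi_apply) (auto simp: fun_scale_def xi_apply sum_distrib_left intro!: sum.cong)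
  qed (use f in simp_all)
  ultimately show ?thesis
    unfolding equivariant_endos_def by (auto simp: xi_equivariant)
qed

lemma schur_simps [simp]:
  "carrier (schur_algebra n d) = equivariant_endos n d"
  "\<phi> \<otimes>\<^bsub>schur_algebra n d\<^esub> \<psi> = compose (tuple_funs n d) \<phi> \<psi>"
  "\<zero>\<^bsub>schur_algebra n d\<^esub> = (\<lambda>f\<in>tuple_funs n d. fun_zero n d)"
  "\<phi> \<oplus>\<^bsub>schur_algebra n d\<^esub> \<psi> = (\<lambda>f\<in>tuple_funs n d. fun_add n d (\<phi> f) (\<psi> f))"
  "a \<odot>\<^bsub>schur_algebra n d\<^esub> \<phi> = (\<lambda>f\<in>tuple_funs n d. fun_scale n d a (\<phi> f))"
  by (simp_all add: schur_algebra_def)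

lemma equivariant_endosD:
  assumes "\<phi> \<in> equivariant_endos n d"
  shows "f \<in> tuple_funs n d \<Longrightarrow> \<phi> f \<in> tuple_funs n d"
    and "\<phi> \<in> extensional (tuple_funs n d)"
    and "f \<in> tuple_funs n d \<Longrightarrow> g \<in> tuple_funs n d \<Longrightarrow> \<phi> (fun_add n d f g) = fun_add n d (\<phi> f) (\<phi> g)"
    and "f \<in> tuple_funs n d \<Longrightarrow> \<phi> (fun_scale n d a f) = fun_scale n d a (\<phi> f)"
    and "w permutes {1..d} \<Longrightarrow> f \<in> tuple_funs n d \<Longrightarrow> \<phi> (perm_rep n d w f) = perm_rep n d w (\<phi> f)"
  using assms unfolding equivariant_endos_def PiE_def by blast+

lemma equivariant_endosI:
  assumes "\<And>f. f \<in> tuple_funs n d \<Longrightarrow> \<phi> f \<in> tuple_funs n d"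
    and "\<And>f g. f \<in> tuple_funs n d \<Longrightarrow> g \<in> tuple_funs n d \<Longrightarrow> \<phi> (fun_add n d f g) = fun_add n d (\<phi> f) (\<phi> g)"
    and "\<And>a f. f \<in> tuple_funs n d \<Longrightarrow> \<phi> (fun_scale n d a f) = fun_scale n d a (\<phi> f)"
    and "\<And>w f. w permutes {1..d} \<Longrightarrow> f \<in> tuple_funs n d \<Longrightarrow> \<phi> (perm_rep n d w f) = perm_rep n d w (\<phi> f)"
  shows "restrict \<phi> (tuple_funs n d) \<in> equivariant_endos n d"
  using assms unfolding equivariant_endos_def by auto

lemma schur_add_closed:
  assumes "\<phi> \<in> equivariant_endos n d" "\<psi> \<in> equivariant_endos n d"
  shows "(\<lambda>f\<in>tuple_funs n d. fun_add n d (\<phi> f) (\<psi> f)) \<in> equivariant_endos n d"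
  by (rule equivariant_endosI)
    (simp_all add: equivariant_endosD[OF assms(1)] equivariant_endosD[OF assms(2)],
     auto simp: fun_add_def fun_scale_def perm_rep_def tuple_act_in_set_tuples algebra_simps
       intro!: restrict_ext)

lemma schur_smult_closed:
  assumes "\<phi> \<in> equivariant_endos n d"
  shows "(\<lambda>f\<in>tuple_funs n d. fun_scale n d a (\<phi> f)) \<in> equivariant_endos n d"
  by (rule equivariant_endosI)
    (simp_all add: equivariant_endosD[OF assms],
     auto simp: fun_add_def fun_scale_def perm_rep_def tuple_act_in_set_tuples algebra_simps
       intro!: restrict_ext)

lemma schur_zero_closed: "(\<lambda>f\<in>tuple_funs n d. fun_zero n d) \<in> equivariant_endos n d"
  by (rule equivariant_endosI)
    (auto simp: fun_zero_def fun_add_def fun_scale_def perm_rep_def tuple_act_in_set_tuples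
       tuple_funs_def intro!: restrict_ext)

lemma fun_add_assoc: "fun_add n d (fun_add n d f g) h = fun_add n d f (fun_add n d g h)"
  and fun_add_commute: "fun_add n d f g = fun_add n d g f"
  by (auto simp: fun_add_def intro!: restrict_ext)

lemma fun_add_zero: "f \<in> tuple_funs n d \<Longrightarrow> fun_add n d (fun_zero n d) f = f"
  by (rule tuple_funs_eqI[OF fun_add_closed]) (auto simp: fun_add_def fun_zero_def)

lemma abelian_monoid_schur_algebra: "abelian_monoid (schur_algebra n d)"
proof (rule abelian_monoidI, goal_cases)
  case (4 \<phi>)
  then have p: "\<phi> \<in> equivariant_endos n d" by simp
  show ?case
    by (rule extensionalityI[of _ "tuple_funs n d"])
      (simp_all add: fun_add_zero equivariant_endosD[OF p])
qed (auto simp: schur_add_closed schur_zero_closed fun_add_assoc intro: restrict_ext fun_add_commute)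

lemma finsum_schur_apply:
  assumes "finite A" and "\<And>x. x \<in> A \<Longrightarrow> g x \<in> equivariant_endos n d"
    and f: "f \<in> tuple_funs n d" and S: "S \<in> set_tuples n d"
  shows "(\<Oplus>\<^bsub>schur_algebra n d\<^esub>x\<in>A. g x) f S = (\<Sum>x\<in>A. g x f S)"
  using assms(1,2)
proof (induction A rule: finite_induct)
  case empty
  interpret abelian_monoid "schur_algebra n d" by (rule abelian_monoid_schur_algebra)
  show ?case using f S by (simp add: fun_zero_def)
next
  case (insert x A)
  interpret abelian_monoid "schur_algebra n d" by (rule abelian_monoid_schur_algebra)
  have "(\<Oplus>\<^bsub>schur_algebra n d\<^esub>x\<in>insert x A. g x) =
      g x \<oplus>\<^bsub>schur_algebra n d\<^esub> (\<Oplus>\<^bsub>schur_algebra n d\<^esub>x\<in>A. g x)"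
    by (rule finsum_insert) (use insert in auto)
  then show ?case using insert f S by (simp add: fun_add_def)
qed

lemma xi_combination_apply:
  assumes f: "f \<in> tuple_funs n d" and S: "S \<in> set_tuples n d"
  shows "(\<Oplus>\<^bsub>schur_algebra n d\<^esub>\<Gamma>\<in>multigraphs n d. c \<Gamma> \<odot>\<^bsub>schur_algebra n d\<^esub> xi n d \<Gamma>) f S =
    (\<Sum>T\<in>set_tuples n d. c (tuple_graph n S T) * f T)"
proof -
  have "(\<Oplus>\<^bsub>schur_algebra n d\<^esub>\<Gamma>\<in>multigraphs n d. c \<Gamma> \<odot>\<^bsub>schur_algebra n d\<^esub> xi n d \<Gamma>) f S =
      (\<Sum>\<Gamma>\<in>multigraphs n d. (c \<Gamma> \<odot>\<^bsub>schur_algebra n d\<^esub> xi n d \<Gamma>) f S)"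
    by (rule finsum_schur_apply[OF _ _ f S]) (simp_all add: schur_smult_closed xi_in_equivariant_endos)
  also have "\<dots> = (\<Sum>\<Gamma>\<in>multigraphs n d. \<Sum>T\<in>set_tuples n d.
      if tuple_graph n S T = \<Gamma> then c \<Gamma> * f T else 0)"
    using f S by (auto simp: fun_scale_def xi_apply sum_distrib_left intro!: sum.cong)
  also have "\<dots> = (\<Sum>T\<in>set_tuples n d. \<Sum>\<Gamma>\<in>multigraphs n d.
      if tuple_graph n S T = \<Gamma> then c \<Gamma> * f T else 0)"
    by (rule sum.swap)
  also have "\<dots> = (\<Sum>T\<in>set_tuples n d. c (tuple_graph n S T) * f T)"
    by (rule sum.cong) (simp_all add: tuple_graph_in_multigraphs[OF S])
  finally show ?thesis .
qed

lemma finsum_schur_closed: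
  assumes "\<And>x. x \<in> A \<Longrightarrow> g x \<in> equivariant_endos n d"
  shows "(\<Oplus>\<^bsub>schur_algebra n d\<^esub>x\<in>A. g x) \<in> equivariant_endos n d"
proof -
  interpret abelian_monoid "schur_algebra n d" by (rule abelian_monoid_schur_algebra)
  show ?thesis using finsum_closed[of g A] assms by auto
qed

text \<open>
  Linear independence of the \<open>\<xi>\<close>'s: at a tuple \<open>S\<close> and the indicator function of \<open>{U}\<close>, where
  \<open>\<Gamma>\<^bsub>S,U\<^esub> = \<Gamma>\<close>, the combination takes the value \<open>c \<Gamma>\<close>.
\<close>
lemma xi_combination_inj:
  fixes c c' :: "_ \<Rightarrow> 'f::field"
  assumes eq: "(\<Oplus>\<^bsub>schur_algebra n d\<^esub>\<Gamma>\<in>multigraphs n d. c \<Gamma> \<odot>\<^bsub>schur_algebra n d\<^esub> xi n d \<Gamma>) =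
      (\<Oplus>\<^bsub>schur_algebra n d\<^esub>\<Gamma>\<in>multigraphs n d. c' \<Gamma> \<odot>\<^bsub>schur_algebra n d\<^esub> xi n d \<Gamma>)"
    and \<Gamma>: "\<Gamma> \<in> multigraphs n d"
  shows "c \<Gamma> = c' \<Gamma>"
proof -
  obtain S U where S: "S \<in> set_tuples n d" and U: "U \<in> set_tuples n d" and SU: "tuple_graph n S U = \<Gamma>"
    using multigraph_is_tuple_graph[OF \<Gamma>] .
  define f :: "(nat \<Rightarrow> nat set) \<Rightarrow> 'f" where "f = (\<lambda>T\<in>set_tuples n d. if T = U then 1 else 0)"
  have f: "f \<in> tuple_funs n d" unfolding f_def tuple_funs_def by simp
  have "(\<Sum>T\<in>set_tuples n d. b (tuple_graph n S T) * f T) = b \<Gamma>" for b :: "_ \<Rightarrow> 'f"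
    using U SU by (simp add: f_def if_distrib[of "\<lambda>x. _ * x"] cong: if_cong)
  then show ?thesis
    using xi_combination_apply[OF f S, of c] xi_combination_apply[OF f S, of c'] eq by simp
qed

lemma xi_mult_apply:
  assumes f: "f \<in> tuple_funs n d" and S: "S \<in> set_tuples n d"
  shows "(xi n d \<Gamma>1 \<otimes>\<^bsub>schur_algebra n d\<^esub> xi n d \<Gamma>2) f S =
    (\<Sum>U\<in>set_tuples n d.
      of_nat (card {T \<in> set_tuples n d. tuple_graph n S T = \<Gamma>1 \<and> tuple_graph n T U = \<Gamma>2}) * f U)"
proof -
  have "(xi n d \<Gamma>1 \<otimes>\<^bsub>schur_algebra n d\<^esub> xi n d \<Gamma>2) f S =
    (\<Sum>T\<in>set_tuples n d. \<Sum>U\<in>set_tuples n d.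
      if tuple_graph n S T = \<Gamma>1 \<and> tuple_graph n T U = \<Gamma>2 then f U else 0)"
    using f S by (auto simp: compose_eq xi_apply intro!: sum.cong)
  also have "\<dots> = (\<Sum>U\<in>set_tuples n d. \<Sum>T\<in>set_tuples n d.
      if tuple_graph n S T = \<Gamma>1 \<and> tuple_graph n T U = \<Gamma>2 then f U else 0)"
    by (rule sum.swap)
  also have "\<dots> = (\<Sum>U\<in>set_tuples n d.
      of_nat (card {T \<in> set_tuples n d. tuple_graph n S T = \<Gamma>1 \<and> tuple_graph n T U = \<Gamma>2}) * f U)"
    by (rule sum.cong) (simp_all add: sum.If_cases Int_def)
  finally show ?thesis .
qed

section \<open>The structure constants\<close>

theorem theorem2p14:
  fixes n d :: nat
    and \<Gamma>1 \<Gamma>2 \<Gamma> :: "(nat \<times> nat) multiset"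
    and l :: "nat \<Rightarrow> nat \<times> nat"
  assumes "CHAR('f::field) \<noteq> 2"
    and "1 \<le> n" and "1 \<le> d"
    and "\<Gamma>1 \<in> multigraphs n d" and "\<Gamma>2 \<in> multigraphs n d" and "\<Gamma> \<in> multigraphs n d"
    and "l \<in> labellings n d \<Gamma>"
  shows "(structure_constant n d \<Gamma>1 \<Gamma>2 \<Gamma> :: 'f) =
    of_nat (card {(l1, l2). l1 \<in> labellings n d \<Gamma>1 \<and> l2 \<in> labellings n d \<Gamma>2 \<and> compatible d l1 l2 l})"
proof -
  have "\<forall>\<Delta>. \<exists>m. \<Delta> \<in> multigraphs n d \<longrightarrow> m \<in> labellings n d \<Delta>"
    using labellings_nonempty by metis
  then obtain L where L: "\<And>\<Delta>. \<Delta> \<in> multigraphs n d \<Longrightarrow> L \<Delta> \<in> labellings n d \<Delta>"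
    by metis
  \<comment> \<open>The candidate coefficients, computed with one chosen labelling of each multigraph.\<close>
  define c :: "_ \<Rightarrow> 'f" where
    "c = (\<lambda>\<Delta>\<in>multigraphs n d. of_nat (card (compatible_pairs n d \<Gamma>1 \<Gamma>2 (L \<Delta>))))"
  have ext: "c \<in> multigraphs n d \<rightarrow>\<^sub>E UNIV" unfolding c_def by simp
  let ?rhs = "\<lambda>c :: _ \<Rightarrow> 'f. \<Oplus>\<^bsub>schur_algebra n d\<^esub>\<Gamma>\<in>multigraphs n d. c \<Gamma> \<odot>\<^bsub>schur_algebra n d\<^esub> xi n d \<Gamma>"
  have prod: "xi n d \<Gamma>1 \<otimes>\<^bsub>schur_algebra n d\<^esub> xi n d \<Gamma>2 = ?rhs c"
  proof (rule extensionalityI)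
    have endo: "?rhs c \<in> equivariant_endos n d"
      by (rule finsum_schur_closed) (simp add: schur_smult_closed xi_in_equivariant_endos)
    show "xi n d \<Gamma>1 \<otimes>\<^bsub>schur_algebra n d\<^esub> xi n d \<Gamma>2 \<in> extensional (tuple_funs n d)"
      by (simp add: compose_def)
    show "?rhs c \<in> extensional (tuple_funs n d)" by (rule equivariant_endosD(2)[OF endo])
    fix f :: "(nat \<Rightarrow> nat set) \<Rightarrow> 'f" assume f: "f \<in> tuple_funs n d"
    show "(xi n d \<Gamma>1 \<otimes>\<^bsub>schur_algebra n d\<^esub> xi n d \<Gamma>2) f = ?rhs c f"
    proof (rule tuple_funs_eqI)
      show "(xi n d \<Gamma>1 \<otimes>\<^bsub>schur_algebra n d\<^esub> xi n d \<Gamma>2) f \<in> tuple_funs n d"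
        using f by (simp add: compose_eq)
      show "?rhs c f \<in> tuple_funs n d" by (rule equivariant_endosD(1)[OF endo f])
      fix S assume S: "S \<in> set_tuples n d"
      have "of_nat (card {T \<in> set_tuples n d. tuple_graph n S T = \<Gamma>1 \<and> tuple_graph n T U = \<Gamma>2}) =
          c (tuple_graph n S U)" if U: "U \<in> set_tuples n d" for U
        using tuple_graph_in_multigraphs[OF S U]
          card_intermediate_tuples[OF _ assms(4,5) L S U refl] by (simp add: c_def)
      then show "(xi n d \<Gamma>1 \<otimes>\<^bsub>schur_algebra n d\<^esub> xi n d \<Gamma>2) f S = ?rhs c f S"
        unfolding xi_mult_apply[OF f S] xi_combination_apply[OF f S] by (intro sum.cong) simp_all
    qed
  qed
  have "structure_constant n d \<Gamma>1 \<Gamma>2 = c"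
    unfolding structure_constant_def
  proof (rule the_equality)
    show "c \<in> multigraphs n d \<rightarrow>\<^sub>E UNIV \<and> xi n d \<Gamma>1 \<otimes>\<^bsub>schur_algebra n d\<^esub> xi n d \<Gamma>2 = ?rhs c"
      using ext prod by blast
    fix b :: "_ \<Rightarrow> 'f"
    assume b: "b \<in> multigraphs n d \<rightarrow>\<^sub>E UNIV \<and> xi n d \<Gamma>1 \<otimes>\<^bsub>schur_algebra n d\<^esub> xi n d \<Gamma>2 = ?rhs b"
    then have "?rhs b = ?rhs c" using prod by simp
    then show "b = c" using b ext by (intro PiE_ext[of b _ _ c]) (auto intro: xi_combination_inj)
  qed
  then have "(structure_constant n d \<Gamma>1 \<Gamma>2 \<Gamma> :: 'f) = of_nat (card (compatible_pairs n d \<Gamma>1 \<Gamma>2 (L \<Gamma>)))"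
    using assms(6) by (simp add: c_def)
  also have "card (compatible_pairs n d \<Gamma>1 \<Gamma>2 (L \<Gamma>)) = card (compatible_pairs n d \<Gamma>1 \<Gamma>2 l)"
    using card_compatible_pairs_le[OF assms(6,4,5)] L[OF assms(6)] assms(7) by (intro antisym) blast+
  finally show ?thesis unfolding compatible_pairs_def .
qed

end
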